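(* Let $G$ be a locally compact Polish group and $S\subseteq G$. Then $S$ has sharp measure zero if and only if $S$ is sharply $\mathcal M$-additive.
   Context: A Polish group is a topological group whose topology is separable and completely metrizable. For $A,B\subseteq G$, $AB=\{ab:a\in A,b\in B\}$. A set is meager if it is a countable union of nowhere dense sets. A set $X\subseteq G$ is sharply $\mathcal M$-additive if for every meager set $M\subseteq G$ there is a $\sigma$-compact set $K\supseteq X$ such that $MK$ is meager. Sharp measure zero: a sequence $\langle U_n:n\in\omega\rangle$ of sets is a $\gamma$-cover of $X$ if each $x\in X$ belongs to all but finitely many $U_n$; it is a $\gamma$-groupable cover of $X$ if there is a partition $\omega=I_0\cup I_1\cup I_2\cup\dots$ into consecutive finite intervals ($I_{j+1}$ to the right of $I_j$) such that $\langle\bigcup_{n\in I_j}U_n:j\in\omega\rangle$ is a $\gamma$-cover of $X$. A metric space $X$ (or a subset of a metric space, with the restricted metric) has sharp measure zero if for every sequence $\langle\varepsilon_n\rangle$ of positive reals there is a $\gamma$-groupable cover $\langle U_n\rangle$ of $X$ with $\operatorname{diam}U_n\leq\varepsilon_n$ for all $n$. In a (separable) locally compact metrizable group, whether a subset has sharp measure zero does not depend on the choice of the metric compatible with the topology, so no metric is specified; any compatible metric may be used. *)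

theory Defs
  imports "HOL-Analysis.Analysis" "HOL-Library.Set_Algebras"
begin

text \<open>
  The group operation is written additively, because the library's class of topological groups is
  \<^class>\<open>topological_group_add\<close>. That class does not assume commutativity. The product
  \<open>AB = {ab : a \<in> A, b \<in> B}\<close> of two sets is therefore \<open>A + B\<close>, with the addition of sets
  from \<^theory>\<open>HOL-Library.Set_Algebras\<close>; the order of the factors matters.
\<close>

definition nowhere_dense :: "'a::topological_space set \<Rightarrow> bool" where
  "nowhere_dense A \<longleftrightarrow> interior (closure A) = {}"

definition meager :: "'a::topological_space set \<Rightarrow> bool" where
  "meager M \<longleftrightarrow> (\<exists>N :: nat \<Rightarrow> 'a set. (\<forall>n. nowhere_dense (N n)) \<and> M = (\<Union>n. N n))"

definition sigma_compact :: "'a::topological_space set \<Rightarrow> bool" where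
  "sigma_compact K \<longleftrightarrow> (\<exists>C :: nat \<Rightarrow> 'a set. (\<forall>n. compact (C n)) \<and> K = (\<Union>n. C n))"

definition sharply_meager_additive :: "'a::topological_group_add set \<Rightarrow> bool" where
  "sharply_meager_additive X \<longleftrightarrow>
     (\<forall>M. meager M \<longrightarrow> (\<exists>K. sigma_compact K \<and> X \<subseteq> K \<and> meager (M + K)))"

definition gamma_cover :: "(nat \<Rightarrow> 'a set) \<Rightarrow> 'a set \<Rightarrow> bool" where
  "gamma_cover U X \<longleftrightarrow> (\<forall>x\<in>X. finite {n. x \<notin> U n})"

text \<open>
  A partition of the natural numbers into consecutive finite (nonempty) intervals \<open>I j\<close> is given
  by the strictly increasing sequence \<open>e\<close> of their left end points: \<open>I j = {e j..<e (Suc j)}\<close>.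
\<close>

definition gamma_groupable_cover :: "(nat \<Rightarrow> 'a set) \<Rightarrow> 'a set \<Rightarrow> bool" where
  "gamma_groupable_cover U X \<longleftrightarrow>
     (\<exists>e :: nat \<Rightarrow> nat. strict_mono e \<and> e 0 = 0 \<and>
        gamma_cover (\<lambda>j. \<Union>n\<in>{e j..<e (Suc j)}. U n) X)"

text \<open>
  The diameter takes extended values, so that unbounded sets have diameter \<open>\<infinity>\<close> (the real-valued
  \<^const>\<open>diameter\<close> is unspecified on them, and is tied to \<^const>\<open>dist\<close>); the empty set has
  diameter \<open>0\<close>.
\<close>

definition ediam :: "('a \<Rightarrow> 'a \<Rightarrow> real) \<Rightarrow> 'a set \<Rightarrow> ennreal" where
  "ediam d U = (SUP x\<in>U. SUP y\<in>U. ennreal (d x y))"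

definition sharp_measure_zero :: "('a \<Rightarrow> 'a \<Rightarrow> real) \<Rightarrow> 'a set \<Rightarrow> bool" where
  "sharp_measure_zero d X \<longleftrightarrow>
     (\<forall>\<epsilon> :: nat \<Rightarrow> real. (\<forall>n. 0 < \<epsilon> n) \<longrightarrow>
        (\<exists>U. gamma_groupable_cover U X \<and> (\<forall>n. ediam d (U n) \<le> ennreal (\<epsilon> n))))"

definition compatible_metric :: "('a::topological_space \<Rightarrow> 'a \<Rightarrow> real) \<Rightarrow> bool" where
  "compatible_metric d \<longleftrightarrow>
     Metric_space UNIV d \<and> Metric_space.mtopology UNIV d = (euclidean :: 'a topology)"

end

theory Submission
  imports Defs
begin

text \<open>
  Both implications rest on one observation about small sets and translates: smallness can be
  demanded uniformly over a compact set, before anything else is known.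

  From sharp measure zero to additivity, it suffices to treat increasing sequences of closed sets
  \<open>C n\<close> with empty interior and of compact sets \<open>L n\<close> exhausting the group. Given a nonempty open
  set \<open>Q\<close> and any \<open>y\<close>, the translate \<open>C n + y\<close> misses a nonempty open part of \<open>Q\<close>, and misses it
  robustly in \<open>y\<close>; compactness of \<open>L n\<close> makes finitely many open parts of \<open>Q\<close> sufficient for all
  sets of diameter at most some \<open>\<delta>\<close> (\<open>escape_small_translates\<close>). Hence the bounds
  \<open>\<epsilon> n\<close> can be fixed in advance so that, whatever the sets \<open>U n\<close> of diameter at most \<open>\<epsilon> n\<close> will
  be, one can shrink a basic open set step by step along an interval of indices, avoiding
  \<open>C n + U n\<close> at each step \<open>n\<close>. At the end of the interval all the sets \<open>U n\<close> with \<open>n\<close> in it have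
  been avoided together, and this makes the sum of \<open>C m\<close> with the set of points covered by every
  late interval nowhere dense.

  From additivity to sharp measure zero, let \<open>W n\<close> be neighbourhoods of points that visit every
  nonempty open set infinitely often, so small that \<open>- W n + z\<close> has diameter at most \<open>\<epsilon> n\<close> for all
  \<open>z\<close> in a fixed compact set \<open>L\<close> with interior points (\<open>small_reflected_translates\<close>). The points
  lying in only finitely many \<open>W n\<close> form a meager set \<open>M\<close>. If \<open>M + K\<close> is meager, Baire's theorem
  provides a single \<open>z\<close> in \<open>L\<close> outside \<open>M + K\<close>. Then every \<open>z - x\<close> with \<open>x\<close> in \<open>K\<close> lies in infinitely many
  \<open>W n\<close>, that is, every tail of the sequence of open sets \<open>- W n + z\<close> covers \<open>K\<close>. Since \<open>K\<close> is
  a countable union of compact sets, finite subcovers cut the sequence into the required intervals.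
\<close>

section \<open>Small sets, bases and exhaustions\<close>

lemma ediam_le_iff:
  "ediam d U \<le> ennreal r \<longleftrightarrow> (\<forall>x\<in>U. \<forall>y\<in>U. ennreal (d x y) \<le> ennreal r)"
  unfolding ediam_def by (auto simp: SUP_le_iff)

lemma compatible_metricD:
  assumes "compatible_metric d"
  shows "Metric_space UNIV d" "open {y. d x y < r}"
proof -
  show M: "Metric_space UNIV d" using assms by (simp add: compatible_metric_def)
  interpret Metric_space UNIV d by (rule M)
  have "openin mtopology (mball x r)" by simp
  then show "open {y. d x y < r}"
    using assms by (simp add: compatible_metric_def mball_def)
qed

lemma nonempty_open_base:
  obtains B :: "nat \<Rightarrow> 'a::second_countable_topology set"
  where "\<And>i. open (B i)" "\<And>i. B i \<noteq> {}" "\<And>Q. open Q \<Longrightarrow> Q \<noteq> {} \<Longrightarrow> \<exists>i. B i \<subseteq> Q"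
proof -
  obtain \<B> :: "'a set set" where \<B>: "countable \<B>" "topological_basis \<B>"
    using ex_countable_basis by auto
  define \<C> where "\<C> = \<B> - {{}}"
  have base: "\<exists>B\<in>\<C>. B \<subseteq> Q" if Q: "open Q" "Q \<noteq> {}" for Q
  proof -
    from Q obtain x where "x \<in> Q" by auto
    with \<B>(2) Q(1) obtain B where "B \<in> \<B>" "x \<in> B" "B \<subseteq> Q" by (rule topological_basisE)
    then show ?thesis by (auto simp: \<C>_def)
  qed
  have "\<C> \<noteq> {}" using base[of UNIV] by auto
  moreover have "countable \<C>" using \<B>(1) by (simp add: \<C>_def)
  ultimately have range: "range (from_nat_into \<C>) = \<C>" by (rule range_from_nat_into)
  show thesis
  proof (rule that)
    fix i
    have "from_nat_into \<C> i \<in> \<C>" using range by auto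
    then show "open (from_nat_into \<C> i)" "from_nat_into \<C> i \<noteq> {}"
      using topological_basis_open[OF \<B>(2)] by (auto simp: \<C>_def)
  next
    fix Q :: "'a set"
    assume "open Q" "Q \<noteq> {}"
    then obtain B where "B \<in> \<C>" "B \<subseteq> Q" using base by blast
    then show "\<exists>i. from_nat_into \<C> i \<subseteq> Q" using range by (metis imageE)
  qed
qed

lemma locally_compact_exhaustion:
  assumes "locally_compact_space (euclidean :: 'a::second_countable_topology topology)"
  obtains L :: "nat \<Rightarrow> 'a::second_countable_topology set"
  where "\<And>k. compact (L k)" "incseq L" "(\<Union>k. L k) = UNIV"
proof -
  define \<F> where "\<F> = {U :: 'a set. open U \<and> (\<exists>K. compact K \<and> U \<subseteq> K)}"
  have cover: "\<Union>\<F> = UNIV"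
    using assms by (auto simp: locally_compact_space_def \<F>_def) blast
  obtain \<F>' where \<F>': "\<F>' \<subseteq> \<F>" "countable \<F>'" "\<Union>\<F>' = \<Union>\<F>"
    using Lindelof[of \<F>] by (auto simp: \<F>_def)
  have "\<F>' \<noteq> {}" using \<F>'(3) cover by auto
  define V where "V = from_nat_into \<F>'"
  have rV: "range V = \<F>'" unfolding V_def using \<open>\<F>' \<noteq> {}\<close> \<F>'(2) by (rule range_from_nat_into)
  have "\<exists>K. compact K \<and> V i \<subseteq> K" for i
    using rV \<F>'(1) by (auto simp: \<F>_def)
  then obtain K where K: "\<And>i. compact (K i)" "\<And>i. V i \<subseteq> K i" by metis
  show thesis
  proof (rule that[of "\<lambda>k. \<Union>i\<le>k. K i"])
    show "compact (\<Union>i\<le>k. K i)" for k using K(1) by (intro compact_UN) auto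
    show "incseq (\<lambda>k. \<Union>i\<le>k. K i)" by (auto simp: incseq_def intro: order_trans)
    have "UNIV = (\<Union>i. V i)" using rV \<F>'(3) cover by auto
    also have "\<dots> \<subseteq> (\<Union>k. \<Union>i\<le>k. K i)" using K(2) by blast
    finally show "(\<Union>k. \<Union>i\<le>k. K i) = UNIV" by auto
  qed
qed

section \<open>Meager sets\<close>

lemma nowhere_dense_subset:
  assumes "nowhere_dense B" "A \<subseteq> B"
  shows "nowhere_dense A"
  using assms interior_mono[OF closure_mono[OF assms(2)]] by (auto simp: nowhere_dense_def)

lemma meager_if_covered:
  fixes N :: "nat \<Rightarrow> nat \<Rightarrow> 'a::topological_space set"
  assumes "\<And>m k. nowhere_dense (N m k)" "A \<subseteq> (\<Union>m k. N m k)"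
  shows "meager A"
  unfolding meager_def
proof (intro exI conjI allI)
  fix i
  show "nowhere_dense (N (fst (prod_decode i)) (snd (prod_decode i)) \<inter> A)"
    by (rule nowhere_dense_subset[OF assms(1)]) auto
next
  have "\<exists>i. x \<in> N (fst (prod_decode i)) (snd (prod_decode i))" if "x \<in> A" for x
  proof -
    from that assms(2) obtain m k where "x \<in> N m k" by blast
    then show ?thesis by (intro exI[of _ "prod_encode (m, k)"]) simp
  qed
  then show "A = (\<Union>i. N (fst (prod_decode i)) (snd (prod_decode i)) \<inter> A)" by auto
qed

lemma meager_subset_closed_sequence:
  fixes M :: "'a::topological_space set"
  assumes "meager M"
  obtains C :: "nat \<Rightarrow> 'a set"
  where "\<And>m. closed (C m)" "\<And>m. interior (C m) = {}" "incseq C" "M \<subseteq> (\<Union>m. C m)"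
proof -
  obtain N :: "nat \<Rightarrow> 'a set" where N: "\<And>n. nowhere_dense (N n)" "M = (\<Union>n. N n)"
    using assms by (auto simp: meager_def)
  show thesis
  proof (rule that[of "\<lambda>m. \<Union>i\<le>m. closure (N i)"])
    show "closed (\<Union>i\<le>m. closure (N i))" for m by auto
    show "interior (\<Union>i\<le>m. closure (N i)) = {}" for m
    proof (induction m)
      case 0
      then show ?case using N(1) by (simp add: nowhere_dense_def)
    next
      case (Suc m)
      then show ?case using N(1)[of "Suc m"]
        by (simp add: atMost_Suc interior_closed_Un_empty_interior nowhere_dense_def)
    qed
    show "incseq (\<lambda>m. \<Union>i\<le>m. closure (N i))" by (auto simp: incseq_def intro: order_trans)
    show "M \<subseteq> (\<Union>m. \<Union>i\<le>m. closure (N i))" using N(2) closure_subset by blast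
  qed
qed

lemma meager_empty_interior:
  fixes M :: "'a::polish_space set"
  assumes "meager M"
  shows "interior M = {}"
proof -
  obtain C :: "nat \<Rightarrow> 'a set" where C: "\<And>m. closed (C m)" "\<And>m. interior (C m) = {}" "M \<subseteq> (\<Union>m. C m)"
    using meager_subset_closed_sequence[OF assms] by metis
  have "euclidean interior_of \<Union>(range C) = {}"
    using C completely_metrizable_space_euclidean
    by (intro Baire_category_alt) auto
  then show ?thesis using interior_mono[OF C(3)] by auto
qed

section \<open>From sharp measure zero to additivity\<close>

text \<open>
  Passing from \<open>U\<close> to its closure costs nothing because \<open>W\<close> is open. This is what allows the
  covering sets to be replaced by closed ones, so that they cut out compact sets.
\<close>

lemma open_avoids_sum_closure:
  fixes A U W :: "'a::topological_group_add set"
  assumes "open W" "W \<inter> (A + U) = {}"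
  shows "W \<inter> (A + closure U) = {}"
proof (rule ccontr)
  assume "W \<inter> (A + closure U) \<noteq> {}"
  then obtain a u where au: "a \<in> A" "u \<in> closure U" "a + u \<in> W"
    by (auto elim!: set_plus_elim)
  have "open ((\<lambda>v. a + v) -` W)"
    using assms(1) by (intro open_vimage continuous_intros)
  then have "(\<lambda>v. a + v) -` W \<inter> U \<noteq> {}"
    using open_Int_closure_eq_empty[of "(\<lambda>v. a + v) -` W" U] au by blast
  then obtain v where "v \<in> U" "a + v \<in> W" by blast
  then show False using assms(2) au(1) by blast
qed

text \<open>
  The translate \<open>C + y\<close> is closed with empty interior, so some point of \<open>Q\<close> lies outside it;
  continuity of subtraction thickens this point and \<open>y\<close> to open sets.
\<close>

lemma escape_translates_locally:
  fixes C Q :: "'a::topological_group_add set"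
  assumes "closed C" "interior C = {}" "open Q" "Q \<noteq> {}"
  obtains W V where "open W" "W \<noteq> {}" "W \<subseteq> Q" "open V" "y \<in> V" "W \<inter> (C + V) = {}"
proof -
  have "open ((\<lambda>c. c + y) -` Q)"
    using assms(3) by (intro open_vimage continuous_intros)
  moreover have "(\<lambda>c. c + y) -` Q \<noteq> {}"
  proof -
    from assms(4) obtain q where "q \<in> Q" by auto
    then have "q - y \<in> (\<lambda>c. c + y) -` Q" by simp
    then show ?thesis by blast
  qed
  ultimately obtain c where c: "c + y \<in> Q" "c \<notin> C"
    using assms(2) interior_maximal[of "(\<lambda>c. c + y) -` Q" C] by blast
  define T where "T = (\<lambda>p::'a \<times> 'a. fst p - snd p) -` (- C)"
  have "open T"
    unfolding T_def using assms(1) by (intro open_vimage continuous_intros) auto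
  moreover have "(c + y, y) \<in> T" using c(2) by (simp add: T_def)
  ultimately obtain W V where WV: "open W" "open V" "(c + y, y) \<in> W \<times> V" "W \<times> V \<subseteq> T"
    by (rule open_prod_elim)
  have "W \<inter> (C + V) = {}"
  proof (rule ccontr)
    assume "W \<inter> (C + V) \<noteq> {}"
    then obtain a v where "a \<in> C" "v \<in> V" "a + v \<in> W" by (auto elim!: set_plus_elim)
    then have "(a + v, v) \<in> T" using WV(4) by blast
    then show False using \<open>a \<in> C\<close> by (simp add: T_def)
  qed
  then have "(W \<inter> Q) \<inter> (C + V) = {}" by blast
  then show thesis using that[of "W \<inter> Q" V] WV assms(3) c(1) by auto
qed

text \<open>
  The local escapes are made uniform over \<open>L\<close> by a Lebesgue number argument for the metric \<open>d\<close>. The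
  answers are named by their indices in a base so that a bound \<open>h\<close> expresses that only finitely many
  of them are needed.
\<close>

lemma escape_small_translates:
  fixes C L Q :: "'a::topological_group_add set" and B :: "nat \<Rightarrow> 'a set"
  assumes d: "compatible_metric d"
    and B: "\<And>i. open (B i)" "\<And>Q. open Q \<Longrightarrow> Q \<noteq> {} \<Longrightarrow> \<exists>i. B i \<subseteq> Q"
    and C: "closed C" "interior C = {}" and L: "compact L" and Q: "open Q" "Q \<noteq> {}"
  shows "\<exists>\<delta>>0. \<exists>h. \<forall>U. ediam d U \<le> ennreal \<delta> \<longrightarrow>
           (\<exists>i\<le>h. B i \<subseteq> Q \<and> B i \<inter> (C + (closure U \<inter> L)) = {})"
proof -
  interpret Metric_space UNIV d using d by (rule compatible_metricD)
  have "\<exists>i r. 0 < r \<and> B i \<subseteq> Q \<and> B i \<inter> (C + {v. d y v < 2 * r}) = {}" for y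
  proof -
    obtain W V where W: "open W" "W \<noteq> {}" "W \<subseteq> Q" and V: "open V" "y \<in> V" "W \<inter> (C + V) = {}"
      by (rule escape_translates_locally[OF C Q, where y = y])
    obtain i where i: "B i \<subseteq> W" using B(2) W by blast
    have "openin mtopology V" using V(1) d by (simp add: compatible_metric_def)
    then obtain r where r: "r > 0" "mball y r \<subseteq> V" using V(2) by (auto simp: openin_mtopology)
    \<comment> \<open>The room of a factor two is used for sets that merely meet the smaller ball.\<close>
    have "C + {v. d y v < 2 * (r / 2)} \<subseteq> C + V"
      using r(2) by (intro set_plus_mono2) (auto simp: mball_def)
    then have "B i \<inter> (C + {v. d y v < 2 * (r / 2)}) = {}" using i V(3) by blast
    then show ?thesis using i W(3) r(1) by (intro exI[of _ i] exI[of _ "r / 2"]) auto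
  qed
  then obtain I r where r: "\<And>y. 0 < r y" and BQ: "\<And>y. B (I y) \<subseteq> Q"
    and esc: "\<And>y. B (I y) \<inter> (C + {v. d y v < 2 * r y}) = {}" by metis
  obtain Y where Y: "Y \<subseteq> L" "finite Y" "L \<subseteq> (\<Union>y\<in>Y. {v. d y v < r y})"
  proof (rule compactE_image[OF L, of L "\<lambda>y. {v. d y v < r y}"])
    show "open {v. d y v < r y}" for y using compatible_metricD(2)[OF d] .
    show "L \<subseteq> (\<Union>y\<in>L. {v. d y v < r y})" using r by auto
  qed
  \<comment> \<open>The index \<open>i0\<close> and the value \<open>1\<close> serve the case of an empty \<open>Y\<close>; \<open>i0\<close> also answers every
    set \<open>U\<close> whose closure misses \<open>L\<close>.\<close>
  obtain i0 where i0: "B i0 \<subseteq> Q" using B(2) Q by blast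
  define \<delta> where "\<delta> = Min (insert 1 (r ` Y))"
  define h where "h = Max (insert i0 (I ` Y))"
  have \<delta>: "\<delta> > 0" "\<And>y. y \<in> Y \<Longrightarrow> \<delta> \<le> r y" using Y(2) r by (auto simp: \<delta>_def)
  have h: "i0 \<le> h" "\<And>y. y \<in> Y \<Longrightarrow> I y \<le> h" using Y(2) by (auto simp: h_def)
  have "\<exists>i\<le>h. B i \<subseteq> Q \<and> B i \<inter> (C + (closure U \<inter> L)) = {}" if U: "ediam d U \<le> ennreal \<delta>" for U
  proof (cases "closure U \<inter> L = {}")
    case True
    then show ?thesis using i0 h(1) by (metis Int_empty_right sumset_empty(1))
  next
    case False
    then obtain u where u: "u \<in> closure U" "u \<in> L" by blast
    then obtain y where y: "y \<in> Y" "d y u < r y" using Y(3) by blast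
    have "{v. d y v < r y} \<inter> U \<noteq> {}"
      using u(1) y(2) open_Int_closure_eq_empty[OF compatible_metricD(2)[OF d], of y "r y" U] by blast
    then obtain u' where u': "u' \<in> U" "d y u' < r y" by blast
    have "d y v < 2 * r y" if "v \<in> U" for v
    proof -
      have "ennreal (d u' v) \<le> ennreal \<delta>" using U that u'(1) by (auto simp: ediam_le_iff)
      then have "d u' v \<le> r y" using \<delta>(1) \<delta>(2)[OF y(1)] by (simp add: ennreal_le_iff)
      then show ?thesis using triangle[of y u' v] u'(2) by auto
    qed
    then have "C + U \<subseteq> C + {v. d y v < 2 * r y}" by (intro set_plus_mono2) auto
    then have "B (I y) \<inter> (C + U) = {}" using esc[of y] by blast
    then have "B (I y) \<inter> (C + closure U) = {}" using B(1) by (intro open_avoids_sum_closure)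
    moreover have "C + (closure U \<inter> L) \<subseteq> C + closure U" by (intro set_plus_mono2) auto
    ultimately show ?thesis using BQ[of y] h(2)[OF y(1)] by blast
  qed
  then show ?thesis using \<delta>(1) by blast
qed

lemma escape_small_translates_uniform:
  fixes C L :: "'a::topological_group_add set" and B :: "nat \<Rightarrow> 'a set"
  assumes d: "compatible_metric d"
    and B: "\<And>i. open (B i)" "\<And>i. B i \<noteq> {}" "\<And>Q. open Q \<Longrightarrow> Q \<noteq> {} \<Longrightarrow> \<exists>i. B i \<subseteq> Q"
    and C: "closed C" "interior C = {}" and L: "compact L"
  shows "\<exists>\<delta>>0. \<exists>h. \<forall>U. ediam d U \<le> ennreal \<delta> \<longrightarrow>
           (\<forall>i\<le>p. \<exists>i'\<le>h. B i' \<subseteq> B i \<and> B i' \<inter> (C + (closure U \<inter> L)) = {})"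
proof -
  have "\<forall>i. \<exists>\<delta>>0. \<exists>h. \<forall>U. ediam d U \<le> ennreal \<delta> \<longrightarrow>
          (\<exists>i'\<le>h. B i' \<subseteq> B i \<and> B i' \<inter> (C + (closure U \<inter> L)) = {})"
    using escape_small_translates[OF d B(1) B(3) C L B(1) B(2)] by blast
  then obtain \<delta> h where \<delta>: "\<And>i. \<delta> i > 0" and h: "\<And>i U. ediam d U \<le> ennreal (\<delta> i) \<Longrightarrow>
          (\<exists>i'\<le>h i. B i' \<subseteq> B i \<and> B i' \<inter> (C + (closure U \<inter> L)) = {})"
    by metis
  have pos: "0 < Min (\<delta> ` {..p})" using \<delta> by (subst Min_gr_iff) auto
  have all: "\<exists>i'\<le>Max (h ` {..p}). B i' \<subseteq> B i \<and> B i' \<inter> (C + (closure U \<inter> L)) = {}"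
    if U: "ediam d U \<le> ennreal (Min (\<delta> ` {..p}))" and i: "i \<le> p" for U i
  proof -
    have "ennreal (Min (\<delta> ` {..p})) \<le> ennreal (\<delta> i)" using i by (intro ennreal_leI Min_le) auto
    then obtain i' where i': "i' \<le> h i" "B i' \<subseteq> B i \<and> B i' \<inter> (C + (closure U \<inter> L)) = {}"
      using h[of U i] U order_trans by blast
    have "h i \<le> Max (h ` {..p})" using i by (intro Max_ge) auto
    then show ?thesis using i' order_trans by blast
  qed
  show ?thesis
    by (rule exI, rule conjI, rule pos, rule exI, intro allI impI, rule all)
qed

lemma sharply_meager_additive_if_sharp_measure_zero:
  fixes S :: "'a::{topological_group_add, second_countable_topology} set"
  assumes lc: "locally_compact_space (euclidean :: 'a topology)"
    and d: "compatible_metric d"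
    and S: "sharp_measure_zero d S"
  shows "sharply_meager_additive S"
  unfolding sharply_meager_additive_def
proof (intro allI impI)
  fix M :: "'a set"
  assume "meager M"
  then obtain C :: "nat \<Rightarrow> 'a set" where C: "\<And>m. closed (C m)" "\<And>m. interior (C m) = {}"
      "incseq C" "M \<subseteq> (\<Union>m. C m)"
    using meager_subset_closed_sequence by metis
  obtain L :: "nat \<Rightarrow> 'a set" where L: "\<And>k. compact (L k)" "incseq L" "(\<Union>k. L k) = UNIV"
    using locally_compact_exhaustion[OF lc] by metis
  obtain B :: "nat \<Rightarrow> 'a set" where B: "\<And>i. open (B i)" "\<And>i. B i \<noteq> {}"
      "\<And>Q. open Q \<Longrightarrow> Q \<noteq> {} \<Longrightarrow> \<exists>i. B i \<subseteq> Q"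
    using nonempty_open_base by metis
  have "\<forall>n p. \<exists>\<delta>>0. \<exists>h. \<forall>U. ediam d U \<le> ennreal \<delta> \<longrightarrow>
           (\<forall>i\<le>p. \<exists>i'\<le>h. B i' \<subseteq> B i \<and> B i' \<inter> (C n + (closure U \<inter> L n)) = {})"
    using escape_small_translates_uniform[OF d B C(1) C(2) L(1)] by blast
  then obtain \<delta> h where \<delta>: "\<And>n p. \<delta> n p > 0"
    and h: "\<And>n p U i. ediam d U \<le> ennreal (\<delta> n p) \<Longrightarrow> i \<le> p \<Longrightarrow>
           \<exists>i'\<le>h n p. B i' \<subseteq> B i \<and> B i' \<inter> (C n + (closure U \<inter> L n)) = {}"
    by metis
  \<comment> \<open>The moves available before step \<open>n\<close> are the basic sets with index at most \<open>p n\<close>. They include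
    all answers given at the previous step, and by \<open>p_ge\<close> each basic set is available from some
    step on. The bound on the diameter at step \<open>n\<close> depends on \<open>p n\<close> only, not on the sets chosen.\<close>
  define p where "p = rec_nat 0 (\<lambda>n q. max (Suc n) (h n q))"
  have p: "p (Suc n) \<ge> Suc n" "p (Suc n) \<ge> h n (p n)" for n by (simp_all add: p_def)
  have p_ge: "n \<le> p n" for n using p(1) by (cases n) auto
  have "\<exists>U. gamma_groupable_cover U S \<and> (\<forall>n. ediam d (U n) \<le> ennreal (\<delta> n (p n)))"
    using \<delta> by (intro S[unfolded sharp_measure_zero_def, rule_format])
  then obtain U where U: "gamma_groupable_cover U S" "\<And>n. ediam d (U n) \<le> ennreal (\<delta> n (p n))"
    by blast
  obtain e where e: "strict_mono e" "gamma_cover (\<lambda>j. \<Union>n\<in>{e j..<e (Suc j)}. U n) S"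
    using U(1) by (auto simp: gamma_groupable_cover_def)
  define A where "A k = L k \<inter> (\<Inter>j\<in>{k..}. \<Union>n\<in>{e j..<e (Suc j)}. closure (U n))" for k
  have "sigma_compact (\<Union>k. A k)"
    unfolding sigma_compact_def
  proof (intro exI conjI allI)
    show "compact (A k)" for k
      unfolding A_def by (intro compact_Int_closed L closed_INT closed_UN ballI) auto
  qed simp
  moreover have "S \<subseteq> (\<Union>k. A k)"
  proof
    fix x
    assume x: "x \<in> S"
    then have "finite {j. x \<notin> (\<Union>n\<in>{e j..<e (Suc j)}. U n)}"
      using e(2) by (auto simp: gamma_cover_def)
    then obtain k1 where k1: "\<And>j. x \<notin> (\<Union>n\<in>{e j..<e (Suc j)}. U n) \<Longrightarrow> j < k1"
      unfolding finite_nat_set_iff_bounded by blast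
    obtain k2 where k2: "x \<in> L k2" using L(3) by blast
    have "x \<in> L (max k1 k2)" using k2 incseqD[OF L(2), of k2 "max k1 k2"] by auto
    moreover have "x \<in> (\<Union>n\<in>{e j..<e (Suc j)}. closure (U n))" if "j \<ge> max k1 k2" for j
      using that k1[of j] closure_subset by fastforce
    ultimately have "x \<in> A (max k1 k2)" by (auto simp: A_def)
    then show "x \<in> (\<Union>k. A k)" by blast
  qed
  moreover have "nowhere_dense (C m + A k)" for m k
  proof -
    have sparse: "\<exists>W. open W \<and> W \<noteq> {} \<and> W \<subseteq> Q \<and> W \<inter> (C m + A k) = {}" if Q: "open Q" "Q \<noteq> {}" for Q
    proof -
      obtain i where i: "B i \<subseteq> Q" using B(3) Q by blast
      \<comment> \<open>One interval that lies beyond \<open>i\<close>, \<open>m\<close> and \<open>k\<close> suffices: the set \<open>B i\<close> is then an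
        available move, and monotonicity gives \<open>C m \<subseteq> C n\<close> and \<open>L k \<subseteq> L n\<close> throughout it.\<close>
      define j where "j = max i (max m k)"
      have ej: "j \<le> e j" using e(1) by (rule strict_mono_imp_increasing)
      have step: "\<exists>i'\<le>p (e j + t). B i' \<subseteq> Q \<and>
          (\<forall>n\<in>{e j..<e j + t}. B i' \<inter> (C n + (closure (U n) \<inter> L n)) = {})" for t
      proof (induction t)
        case 0
        have "i \<le> p (e j)" using p_ge[of "e j"] ej by (simp add: j_def)
        then show ?case using i by auto
      next
        case (Suc t)
        then obtain i' where i': "i' \<le> p (e j + t)" "B i' \<subseteq> Q"
            "\<forall>n\<in>{e j..<e j + t}. B i' \<inter> (C n + (closure (U n) \<inter> L n)) = {}" by blast
        obtain i'' where i'': "i'' \<le> h (e j + t) (p (e j + t))" "B i'' \<subseteq> B i'"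
            "B i'' \<inter> (C (e j + t) + (closure (U (e j + t)) \<inter> L (e j + t))) = {}"
          using h[OF U(2) i'(1)] by blast
        show ?case
        proof (intro exI conjI ballI)
          show "i'' \<le> p (e j + Suc t)" using i''(1) p(2)[of "e j + t"] by simp
          show "B i'' \<subseteq> Q" using i''(2) i'(2) by blast
          show "B i'' \<inter> (C n + (closure (U n) \<inter> L n)) = {}" if "n \<in> {e j..<e j + Suc t}" for n
          proof (cases "n = e j + t")
            case False
            then have "n \<in> {e j..<e j + t}" using that by auto
            then show ?thesis using i'(3) i''(2) by blast
          qed (use i''(3) in simp)
        qed
      qed
      have "e j + (e (Suc j) - e j) = e (Suc j)" using e(1) by (simp add: strict_mono_less_eq)
      then obtain i' where i': "B i' \<subseteq> Q"
          "\<And>n. n \<in> {e j..<e (Suc j)} \<Longrightarrow> B i' \<inter> (C n + (closure (U n) \<inter> L n)) = {}"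
        using step[of "e (Suc j) - e j"] by auto
      have "B i' \<inter> (C m + A k) = {}"
      proof (rule ccontr)
        assume "B i' \<inter> (C m + A k) \<noteq> {}"
        then obtain c a where ca: "c \<in> C m" "a \<in> A k" "c + a \<in> B i'" by (auto elim!: set_plus_elim)
        have "j \<in> {k..}" by (simp add: j_def)
        then obtain n where n: "n \<in> {e j..<e (Suc j)}" "a \<in> closure (U n)"
          using ca(2) unfolding A_def by blast
        have "m \<le> n" "k \<le> n" using n(1) ej by (auto simp: j_def)
        then have "c \<in> C n" "a \<in> L n"
          using ca incseqD[OF C(3), of m n] incseqD[OF L(2), of k n] by (auto simp: A_def)
        then show False using i'(2)[OF n(1)] n(2) ca(3) by blast
      qed
      then show ?thesis using B(1)[of i'] B(2)[of i'] i'(1) by blast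
    qed
    have "interior (closure (C m + A k)) = {}"
    proof (rule ccontr)
      assume "interior (closure (C m + A k)) \<noteq> {}"
      then obtain W where W: "open W" "W \<noteq> {}" "W \<subseteq> closure (C m + A k)" "W \<inter> (C m + A k) = {}"
        using sparse[OF open_interior, of "closure (C m + A k)"] interior_subset[of "closure (C m + A k)"]
        by blast
      then show False using open_Int_closure_eq_empty[OF W(1)] by blast
    qed
    then show ?thesis by (simp add: nowhere_dense_def)
  qed
  then have "meager (M + (\<Union>k. A k))"
  proof (rule meager_if_covered)
    show "M + (\<Union>k. A k) \<subseteq> (\<Union>m k. C m + A k)"
    proof
      fix x
      assume "x \<in> M + (\<Union>k. A k)"
      then obtain c a where x: "x = c + a" "c \<in> M" "a \<in> (\<Union>k. A k)" by (blast elim: set_plus_elim)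
      then obtain m k where "c \<in> C m" "a \<in> A k" using C(4) by blast
      then show "x \<in> (\<Union>m k. C m + A k)" using x(1) by blast
    qed
  qed
  ultimately show "\<exists>K. sigma_compact K \<and> S \<subseteq> K \<and> meager (M + K)" by blast
qed

section \<open>From additivity to sharp measure zero\<close>

text \<open>
  The bound has to hold for all \<open>z\<close> in \<open>L\<close> at once, since the neighbourhoods \<open>W\<close> determine the
  meager set on which the eventual choice of \<open>z\<close> depends. The metric \<open>d\<close> need not be invariant, so
  uniformity comes from compactness of \<open>L\<close> and joint continuity of \<open>(w, z) \<mapsto> - w + z\<close>.
\<close>

lemma small_reflected_translates:
  fixes q :: "'a::topological_group_add"
  assumes d: "compatible_metric d" and L: "compact L" and \<epsilon>: "\<epsilon> > 0"
  shows "\<exists>W. open W \<and> q \<in> W \<and> (\<forall>z\<in>L. ediam d ((\<lambda>w. - w + z) ` W) \<le> ennreal \<epsilon>)"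
proof -
  interpret Metric_space UNIV d using d by (rule compatible_metricD)
  have "\<exists>W N. open W \<and> open N \<and> q \<in> W \<and> z \<in> N \<and>
          (\<forall>w\<in>W. \<forall>z'\<in>N. d (- q + z) (- w + z') < \<epsilon> / 2)" for z
  proof -
    define T where "T = (\<lambda>p::'a \<times> 'a. - fst p + snd p) -` {v. d (- q + z) v < \<epsilon> / 2}"
    have "open T"
      unfolding T_def using compatible_metricD(2)[OF d] by (intro open_vimage continuous_intros)
    moreover have "(q, z) \<in> T" using \<epsilon> by (simp add: T_def)
    ultimately obtain W N where "open W" "open N" "(q, z) \<in> W \<times> N" "W \<times> N \<subseteq> T"
      by (rule open_prod_elim)
    then show ?thesis by (intro exI[of _ W] exI[of _ N]) (auto simp: T_def)
  qed
  then obtain W N where W: "\<And>z. open (W z)" "\<And>z. q \<in> W z" and N: "\<And>z. open (N z)" "\<And>z. z \<in> N z"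
    and WN: "\<And>z w z'. w \<in> W z \<Longrightarrow> z' \<in> N z \<Longrightarrow> d (- q + z) (- w + z') < \<epsilon> / 2" by metis
  obtain Z where Z: "Z \<subseteq> L" "finite Z" "L \<subseteq> (\<Union>z\<in>Z. N z)"
    by (rule compactE_image[OF L, of L N]) (use N in auto)
  show ?thesis
  proof (intro exI conjI ballI)
    show "open (\<Inter>z\<in>Z. W z)" using Z(2) W(1) by (intro open_INT) auto
    show "q \<in> (\<Inter>z\<in>Z. W z)" using W(2) by blast
    fix z'
    assume "z' \<in> L"
    then obtain z where z: "z \<in> Z" "z' \<in> N z" using Z(3) by blast
    have "d (- v + z') (- w + z') \<le> \<epsilon>" if "v \<in> (\<Inter>z\<in>Z. W z)" "w \<in> (\<Inter>z\<in>Z. W z)" for v w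
      using WN[OF _ z(2), of v] WN[OF _ z(2), of w] that z(1)
        triangle''[of "- v + z'" "- q + z" "- w + z'"] by auto
    then show "ediam d ((\<lambda>w. - w + z') ` (\<Inter>z\<in>Z. W z)) \<le> ennreal \<epsilon>"
      unfolding ediam_le_iff by (auto intro!: ennreal_leI)
  qed
qed

lemma sharp_measure_zero_if_sharply_meager_additive:
  fixes S :: "'a::{topological_group_add, polish_space} set"
  assumes lc: "locally_compact_space (euclidean :: 'a topology)"
    and d: "compatible_metric d"
    and S: "sharply_meager_additive S"
  shows "sharp_measure_zero d S"
  unfolding sharp_measure_zero_def
proof (intro allI impI)
  fix \<epsilon> :: "nat \<Rightarrow> real"
  assume \<epsilon>: "\<forall>n. 0 < \<epsilon> n"
  obtain V L :: "'a set" where L: "open V" "V \<noteq> {}" "compact L" "V \<subseteq> L"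
    using lc by (auto simp: locally_compact_space_def) blast
  obtain B :: "nat \<Rightarrow> 'a set" where B: "\<And>i. open (B i)" "\<And>i. B i \<noteq> {}"
      "\<And>Q. open Q \<Longrightarrow> Q \<noteq> {} \<Longrightarrow> \<exists>i. B i \<subseteq> Q"
    using nonempty_open_base by metis
  have "\<forall>i. \<exists>x. x \<in> B i" using B(2) by blast
  then obtain b where b: "\<And>i. b i \<in> B i" by metis
  \<comment> \<open>Under the pairing \<open>n \<mapsto> fst (prod_decode n)\<close> every point \<open>b i\<close> occurs infinitely often, so
    that every tail of the sequence of neighbourhoods has dense union, even at isolated points.\<close>
  have "\<forall>n. \<exists>W. open W \<and> b (fst (prod_decode n)) \<in> W \<and>
          (\<forall>z\<in>L. ediam d ((\<lambda>w. - w + z) ` W) \<le> ennreal (\<epsilon> n))"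
    using small_reflected_translates[OF d L(3)] \<epsilon> by blast
  then obtain W where W: "\<And>n. open (W n)" "\<And>n. b (fst (prod_decode n)) \<in> W n"
      "\<And>n z. z \<in> L \<Longrightarrow> ediam d ((\<lambda>w. - w + z) ` W n) \<le> ennreal (\<epsilon> n)" by metis
  define N where "N m = (\<Inter>n\<in>{m..}. - W n)" for m
  have "nowhere_dense (N m)" for m
  proof -
    have "closed (N m)" unfolding N_def using W(1) by auto
    moreover have "interior (N m) = {}"
    proof (rule ccontr)
      assume "interior (N m) \<noteq> {}"
      then obtain i where i: "B i \<subseteq> interior (N m)" using B(3) by blast
      have "m \<le> prod_encode (i, m)" by (rule le_prod_encode_2)
      then have "b i \<notin> N m" using W(2)[of "prod_encode (i, m)"] by (auto simp: N_def)
      then show False using b i interior_subset by blast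
    qed
    ultimately show ?thesis by (simp add: nowhere_dense_def)
  qed
  then have "meager (\<Union>m. N m)" by (auto simp: meager_def)
  then obtain K where K: "sigma_compact K" "S \<subseteq> K" "meager ((\<Union>m. N m) + K)"
    using S by (auto simp: sharply_meager_additive_def)
  obtain z where z: "z \<in> L" "z \<notin> (\<Union>m. N m) + K"
    using meager_empty_interior[OF K(3)] interior_maximal[OF _ L(1)] L(2,4) by blast
  define U where "U n = (\<lambda>w. - w + z) ` W n" for n
  have openU: "open (U n)" for n
  proof -
    have cancel: "z - (- w + z) = w" for w by (simp add: diff_eq_eq)
    have "U n = (\<lambda>x. z - x) -` W n"
    proof (intro set_eqI iffI)
      fix x
      assume "x \<in> (\<lambda>x. z - x) -` W n"
      moreover have "x = - (z - x) + z" by simp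
      ultimately show "x \<in> U n" unfolding U_def by blast
    qed (auto simp: U_def cancel)
    moreover have "open ((\<lambda>x. z - x) -` W n)"
      using W(1) by (intro open_vimage continuous_intros)
    ultimately show ?thesis by simp
  qed
  have cover: "K \<subseteq> (\<Union>n\<in>{m..}. U n)" for m
  proof
    fix x
    assume x: "x \<in> K"
    have "z - x \<notin> N m"
    proof
      assume "z - x \<in> N m"
      then have "(z - x) + x \<in> (\<Union>m. N m) + K" using x by (intro set_plus_intro) auto
      then show False using z(2) by simp
    qed
    then obtain n where n: "n \<ge> m" "z - x \<in> W n" by (auto simp: N_def)
    have "x = - (z - x) + z" by simp
    then have "x \<in> U n" unfolding U_def using n(2) by blast
    then show "x \<in> (\<Union>n\<in>{m..}. U n)" using n(1) by blast
  qed
  obtain A :: "nat \<Rightarrow> 'a set" where A: "\<And>k. compact (A k)" "K = (\<Union>k. A k)"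
    using K(1) by (auto simp: sigma_compact_def)
  have interval: "\<exists>m'>m. (\<Union>k\<le>j. A k) \<subseteq> (\<Union>n\<in>{m..<m'}. U n)" for j m
  proof -
    have "compact (\<Union>k\<le>j. A k)" using A(1) by (intro compact_UN) auto
    moreover have "\<And>n. n \<in> {m..} \<Longrightarrow> open (U n)" by (rule openU)
    moreover have "(\<Union>k\<le>j. A k) \<subseteq> (\<Union>n\<in>{m..}. U n)" using cover[of m] A(2) by blast
    ultimately obtain F where F: "F \<subseteq> {m..}" "finite F" "(\<Union>k\<le>j. A k) \<subseteq> (\<Union>n\<in>F. U n)"
      by (rule compactE_image)
    obtain m' where m': "F \<subseteq> {..<m'}" using F(2) finite_nat_bounded by blast
    have "F \<subseteq> {m..<max m' (Suc m)}" using F(1) m' by fastforce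
    then have "(\<Union>k\<le>j. A k) \<subseteq> (\<Union>n\<in>{m..<max m' (Suc m)}. U n)" using F(3) by blast
    then show ?thesis by (intro exI[of _ "max m' (Suc m)"]) simp
  qed
  have "\<forall>j m. \<exists>m'>m. (\<Union>k\<le>j. A k) \<subseteq> (\<Union>n\<in>{m..<m'}. U n)"
    using interval by blast
  then obtain f where f: "\<And>j m. f j m > m" "\<And>j m. (\<Union>k\<le>j. A k) \<subseteq> (\<Union>n\<in>{m..<f j m}. U n)"
    by metis
  define e where "e = rec_nat 0 f"
  have e: "e 0 = 0" "e (Suc j) = f j (e j)" for j by (simp_all add: e_def)
  have "gamma_groupable_cover U S"
    unfolding gamma_groupable_cover_def
  proof (intro exI conjI)
    show "strict_mono e" using e(2) f(1) by (simp add: strict_mono_Suc_iff)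
    show "e 0 = 0" by (rule e)
    show "gamma_cover (\<lambda>j. \<Union>n\<in>{e j..<e (Suc j)}. U n) S"
      unfolding gamma_cover_def
    proof
      fix x
      assume "x \<in> S"
      then obtain k where k: "x \<in> A k" using K(2) A(2) by blast
      have "x \<in> (\<Union>n\<in>{e j..<e (Suc j)}. U n)" if "k \<le> j" for j
        using f(2)[of j "e j"] k that unfolding e(2) by blast
      then have "{j. x \<notin> (\<Union>n\<in>{e j..<e (Suc j)}. U n)} \<subseteq> {..<k}" by (force simp: not_le)
      then show "finite {j. x \<notin> (\<Union>n\<in>{e j..<e (Suc j)}. U n)}" by (rule finite_subset) simp
    qed
  qed
  moreover have "ediam d (U n) \<le> ennreal (\<epsilon> n)" for n
    unfolding U_def using z(1) by (rule W(3))
  ultimately show "\<exists>U. gamma_groupable_cover U S \<and> (\<forall>n. ediam d (U n) \<le> ennreal (\<epsilon> n))" by blast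
qed

theorem theorem1p2:
  fixes S :: "'a::{topological_group_add, polish_space} set"
    and d :: "'a \<Rightarrow> 'a \<Rightarrow> real"
  assumes "locally_compact_space (euclidean :: 'a topology)"
    and "compatible_metric d"
  shows "sharp_measure_zero d S \<longleftrightarrow> sharply_meager_additive S"
  using sharply_meager_additive_if_sharp_measure_zero[OF assms]
    sharp_measure_zero_if_sharply_meager_additive[OF assms] by blast

end
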